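(* Let $t,k,v$ be integers with $k\ge t\ge 2$ and $v\ge 2$. Then \[ \mathsf{CAN}(t,k,v)\le\frac{\log\left\{e\,t\binom{k}{t-1}\right\}}{\log\left(\frac{v^{t}}{v^{t}-1}\right)}+\left\lfloor k\,\frac{e^{t}(v^{t}-1)}{t^{2}}\left(1-\frac{1}{t}\right)^{t-1}\right\rfloor . \]
   Context: The logarithm is the natural logarithm and $e$ is its base. For positive integers $N,t,k,v$ with $k\ge t\ge 2$ and $v\ge 2$, a covering array $\mathsf{CA}(N;t,k,v)$ is an $N\times k$ array $A$ with entries from an alphabet $\Sigma$ of size $v$ such that for every $N\times t$ subarray $B$ of $A$ (obtained by choosing $t$ of the $k$ columns) and every $\mathbf{x}\in\Sigma^{t}$, some row of $B$ equals $\mathbf{x}$. $\mathsf{CAN}(t,k,v)$ is the smallest $N$ for which a $\mathsf{CA}(N;t,k,v)$ exists. *)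

theory Defs
  imports Complex_Main "HOL-Library.FuncSet"
begin

text \<open>
  An \<open>N \<times> k\<close> array is a function \<open>A\<close> of row index \<open>i < N\<close> and column index \<open>j < k\<close>; its values
  outside this range are irrelevant. The chosen columns form a \<open>t\<close>-subset \<open>C\<close> of \<open>{..<k}\<close>, and a
  tuple in \<open>S\<^sup>t\<close> is indexed by the elements of \<open>C\<close>.
\<close>

definition covering_array ::
    "'a set \<Rightarrow> nat \<Rightarrow> nat \<Rightarrow> nat \<Rightarrow> nat \<Rightarrow> (nat \<Rightarrow> nat \<Rightarrow> 'a) \<Rightarrow> bool" where
  "covering_array S N t k v A \<longleftrightarrow>
     finite S \<and> card S = v \<and>
     (\<forall>i<N. \<forall>j<k. A i j \<in> S) \<and>
     (\<forall>C x. C \<subseteq> {..<k} \<and> card C = t \<and> x \<in> C \<rightarrow>\<^sub>E S \<longrightarrow>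
        (\<exists>i<N. \<forall>j\<in>C. A i j = x j))"

text \<open>
  Relabelling the symbols preserves the covering property, so the alphabet of size \<open>v\<close> is taken to
  be \<open>{..<v}\<close>. The minimum is over a nonempty set: list all \<open>v\<^sup>k\<close> rows.
\<close>

definition CAN :: "nat \<Rightarrow> nat \<Rightarrow> nat \<Rightarrow> nat" where
  "CAN t k v = (LEAST N. 0 < N \<and> (\<exists>A. covering_array {..<v} N t k v A))"

end

(* A uniformly random row covers a fixed interaction (a choice of t columns together with a t-tuple
   of symbols) with probability 1/v^t.  Hence some row covers at least that fraction of any given set
   of interactions, and after n greedily chosen rows at most (k choose t) v^t (1 - 1/v^t)^n
   interactions remain uncovered.  Each remaining interaction is covered by one extra row.  With n
   the integer part of the logarithmic term, the number of remaining interactions is bounded by the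
   linear term; this leaves enough room that no local lemma is needed. *)
theory Submission
  imports Defs
begin

text \<open>\<open>PiE\<close> fixes the value of a tuple off \<open>C\<close>, so distinct
  functions are distinct tuples and interactions can be counted.\<close>

definition interactions :: "'c set \<Rightarrow> 'a set \<Rightarrow> nat \<Rightarrow> ('c set \<times> ('c \<Rightarrow> 'a)) set" where
  "interactions K S t = (SIGMA C:{C. C \<subseteq> K \<and> card C = t}. C \<rightarrow>\<^sub>E S)"

definition covers :: "('c \<Rightarrow> 'a) \<Rightarrow> 'c set \<times> ('c \<Rightarrow> 'a) \<Rightarrow> bool" where
  "covers r u \<longleftrightarrow> (\<forall>j\<in>fst u. r j = snd u j)"

lemma finite_interactions:
  assumes "finite K" "finite S"
  shows "finite (interactions K S t)"
  unfolding interactions_def using assms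
  by (intro finite_SigmaI finite_PiE) (auto intro: finite_subset)

lemma card_interactions:
  assumes "finite K" "finite S"
  shows "card (interactions K S t) = (card K choose t) * card S ^ t"
proof -
  have fin: "finite C" if "C \<subseteq> K" for C
    using that assms(1) by (rule finite_subset)
  have "card (interactions K S t) = (\<Sum>C\<in>{C. C \<subseteq> K \<and> card C = t}. card (C \<rightarrow>\<^sub>E S))"
    unfolding interactions_def using assms fin
    by (intro card_SigmaI) (auto intro!: finite_PiE)
  also have "\<dots> = (\<Sum>C\<in>{C. C \<subseteq> K \<and> card C = t}. card S ^ t)"
    using fin by (intro sum.cong refl) (auto simp: card_PiE)
  also have "\<dots> = (card K choose t) * card S ^ t"
    by (simp add: n_subsets[OF assms(1)])
  finally show ?thesis .
qed

text \<open>A covering row is forced on the \<open>t\<close> columns of \<open>u\<close> and free on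
  the other \<open>card K - t\<close>.\<close>

lemma card_covering_rows:
  assumes "finite K" "u \<in> interactions K S t"
  shows "card {r \<in> K \<rightarrow>\<^sub>E S. covers r u} = card S ^ (card K - t)"
proof -
  obtain C x where u: "u = (C, x)" and C: "C \<subseteq> K" "card C = t" and x: "x \<in> C \<rightarrow>\<^sub>E S"
    using assms(2) by (auto simp: interactions_def)
  have finC: "finite C" using C(1) assms(1) by (rule finite_subset)
  have "{r \<in> K \<rightarrow>\<^sub>E S. covers r u} = (\<Pi>\<^sub>E j\<in>K. if j \<in> C then {x j} else S)"
    using C x by (fastforce simp: u covers_def PiE_iff split: if_splits)
  then have "card {r \<in> K \<rightarrow>\<^sub>E S. covers r u} = (\<Prod>j\<in>K. if j \<in> C then 1 else card S)"
    using assms(1) by (simp add: card_PiE if_distrib cong: if_cong)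
  also have "\<dots> = (\<Prod>j\<in>K - C. card S)"
    using assms(1) by (intro prod.mono_neutral_cong_right) auto
  also have "\<dots> = card S ^ (card K - t)"
    using C finC by (simp add: card_Diff_subset)
  finally show ?thesis .
qed

text \<open>Averaging over all \<open>card S ^ card K\<close> rows: some row does at least as well
  as the mean. The bound is multiplied out to avoid division.\<close>

lemma exists_row_covering_fraction:
  assumes "finite K" "finite S" "S \<noteq> {}" and U: "U \<subseteq> interactions K S t" and t: "t \<le> card K"
  obtains r where "r \<in> K \<rightarrow>\<^sub>E S"
    and "real (card U) \<le> real (card S) ^ t * real (card {u \<in> U. covers r u})"
proof -
  define R where "R = K \<rightarrow>\<^sub>E S"
  define s where "s = real (card S)"
  have s: "s > 0" using assms by (simp add: s_def card_gt_0_iff)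
  have finU: "finite U"
    using U finite_interactions[OF assms(1,2)] by (rule finite_subset)
  have finR: "finite R" and R: "R \<noteq> {}"
    unfolding R_def using assms by (auto intro: finite_PiE simp: PiE_eq_empty_iff)
  have cardR: "real (card R) = s ^ card K"
    using assms(1) by (simp add: R_def s_def card_PiE)
  \<comment> \<open>Double counting of the pairs of a row \<open>r\<close> and an interaction
    \<open>u\<close> in \<open>U\<close> covered by it.\<close>
  have "(\<Sum>r\<in>R. card {u \<in> U. covers r u}) = (\<Sum>u\<in>U. card {r \<in> R. covers r u})"
    using sum.swap_restrict[OF finR finU, of "\<lambda>_ _. 1::nat" covers] by simp
  also have "\<dots> = (\<Sum>u\<in>U. card S ^ (card K - t))"
    unfolding R_def using U by (intro sum.cong refl card_covering_rows[OF assms(1)]) (rule subsetD)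
  finally have dc: "(\<Sum>r\<in>R. real (card {u \<in> U. covers r u})) = real (card U) * s ^ (card K - t)"
    by (simp add: s_def flip: of_nat_sum)
  have "\<exists>r\<in>R. real (card U) \<le> s ^ t * real (card {u \<in> U. covers r u})"
  proof (rule ccontr)
    assume "\<not> ?thesis"
    then have "(\<Sum>r\<in>R. s ^ t * real (card {u \<in> U. covers r u})) < (\<Sum>r\<in>R. real (card U))"
      using finR R by (intro sum_strict_mono) auto
    then have "s ^ t * (real (card U) * s ^ (card K - t)) < s ^ card K * real (card U)"
      by (simp add: dc cardR flip: sum_distrib_left)
    moreover have "s ^ t * s ^ (card K - t) = s ^ card K"
      using t by (simp flip: power_add)
    ultimately show False by (simp add: mult.left_commute mult.commute)
  qed
  then show ?thesis using that by (auto simp: R_def s_def)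
qed

lemma greedy_rows:
  assumes "finite K" "finite S" "S \<noteq> {}" "t \<le> card K"
  shows "\<exists>rs. length rs = n \<and> set rs \<subseteq> K \<rightarrow>\<^sub>E S \<and>
    real (card {u \<in> interactions K S t. \<forall>r\<in>set rs. \<not> covers r u})
      \<le> (1 - 1 / real (card S) ^ t) ^ n * real (card (interactions K S t))"
proof (induction n)
  case 0
  then show ?case by simp
next
  case (Suc n)
  define w where "w = real (card S) ^ t"
  have w: "w \<ge> 1"
    using assms by (simp add: w_def one_le_power card_gt_0_iff Suc_le_eq)
  obtain rs where rs: "length rs = n" "set rs \<subseteq> K \<rightarrow>\<^sub>E S"
    and le: "real (card {u \<in> interactions K S t. \<forall>r\<in>set rs. \<not> covers r u})
      \<le> (1 - 1 / w) ^ n * real (card (interactions K S t))"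
    using Suc by (auto simp: w_def)
  define U where "U = {u \<in> interactions K S t. \<forall>r\<in>set rs. \<not> covers r u}"
  have U: "U \<subseteq> interactions K S t" by (auto simp: U_def)
  then have finU: "finite U"
    using finite_interactions[OF assms(1,2)] by (rule finite_subset)
  obtain r where r: "r \<in> K \<rightarrow>\<^sub>E S" and cov: "real (card U) \<le> w * real (card {u \<in> U. covers r u})"
    using exists_row_covering_fraction[OF assms(1-3) U assms(4)] by (auto simp: w_def)
  have "{u \<in> interactions K S t. \<forall>r'\<in>set (r # rs). \<not> covers r' u} = U - {u \<in> U. covers r u}"
    by (auto simp: U_def)
  then have "real (card {u \<in> interactions K S t. \<forall>r'\<in>set (r # rs). \<not> covers r' u})
      = real (card U) - real (card {u \<in> U. covers r u})"
    using finU by (simp add: card_Diff_subset card_mono of_nat_diff)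
  also have "\<dots> \<le> (1 - 1 / w) * real (card U)"
    using cov w by (simp add: field_simps)
  \<comment> \<open>Since \<open>w \<ge> 1\<close>, the factor \<open>1 - 1 / w\<close> is
    nonnegative and may multiply the induction hypothesis.\<close>
  also have "\<dots> \<le> (1 - 1 / w) * ((1 - 1 / w) ^ n * real (card (interactions K S t)))"
    using le w by (intro mult_left_mono) (auto simp: U_def)
  finally show ?case
    using rs r by (intro exI[of _ "r # rs"]) (auto simp: w_def mult.assoc)
qed

lemma exists_covering_row:
  assumes "S \<noteq> {}" "u \<in> interactions K S t"
  shows "\<exists>r\<in>K \<rightarrow>\<^sub>E S. covers r u"
proof -
  obtain C x where u: "u = (C, x)" "C \<subseteq> K" "x \<in> C \<rightarrow>\<^sub>E S"
    using assms(2) by (auto simp: interactions_def)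
  obtain a where "a \<in> S" using assms(1) by auto
  then show ?thesis using u
    \<comment> \<open>The row copies the tuple on \<open>C\<close> and takes an arbitrary symbol
      \<open>a\<close> in the other columns.\<close>
    by (intro bexI[of _ "\<lambda>j\<in>K. if j \<in> C then x j else a"]) (auto simp: covers_def)
qed

lemma covering_array_nth:
  assumes "finite S" and "set rs \<subseteq> {..<k} \<rightarrow>\<^sub>E S"
    and "\<And>u. u \<in> interactions {..<k} S t \<Longrightarrow> \<exists>r\<in>set rs. covers r u"
  shows "covering_array S (length rs) t k (card S) (\<lambda>i. rs ! i)"
  unfolding covering_array_def
proof (intro conjI allI impI)
  fix i j assume "i < length rs" "j < k"
  then show "(rs ! i) j \<in> S"
    using assms(2) nth_mem[of i rs] by (metis PiE_mem lessThan_iff subsetD)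
next
  fix C x assume "C \<subseteq> {..<k} \<and> card C = t \<and> x \<in> C \<rightarrow>\<^sub>E S"
  then have "(C, x) \<in> interactions {..<k} S t"
    by (auto simp: interactions_def)
  then obtain r where "r \<in> set rs" "covers r (C, x)" using assms(3) by blast
  then show "\<exists>i<length rs. \<forall>j\<in>C. (rs ! i) j = x j"
    by (auto simp: in_set_conv_nth covers_def)
qed (use assms in auto)

text \<open>Here \<open>m\<close> counts the interactions missed by \<open>n\<close> greedy rows.
  One row is appended for each of them; repeated rows do no harm.\<close>

lemma CAN_le_alteration:
  assumes "t \<le> k" "0 < v" "0 < n"
  obtains m where "CAN t k v \<le> n + m"
    and "real m \<le> (1 - 1 / real v ^ t) ^ n * (real (k choose t) * real v ^ t)"
proof -
  let ?S = "{..<v}" and ?K = "{..<k}"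
  have S: "?S \<noteq> {}" using assms(2) by auto
  obtain rs where rs: "length rs = n" "set rs \<subseteq> ?K \<rightarrow>\<^sub>E ?S"
    and le: "real (card {u \<in> interactions ?K ?S t. \<forall>r\<in>set rs. \<not> covers r u})
      \<le> (1 - 1 / real v ^ t) ^ n * real (card (interactions ?K ?S t))"
    using greedy_rows[of ?K ?S t n] S assms(1) by auto
  define U where "U = {u \<in> interactions ?K ?S t. \<forall>r\<in>set rs. \<not> covers r u}"
  have finU: "finite U"
    unfolding U_def by (simp add: finite_interactions)
  then obtain us where us: "set us = U" "length us = card U"
    using finite_distinct_list distinct_card by metis
  have "\<forall>u\<in>U. \<exists>r\<in>?K \<rightarrow>\<^sub>E ?S. covers r u"
    using exists_covering_row[OF S] by (auto simp: U_def)
  then obtain f where f: "\<And>u. u \<in> U \<Longrightarrow> f u \<in> ?K \<rightarrow>\<^sub>E ?S \<and> covers (f u) u"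
    by metis
  have "covering_array ?S (length (rs @ map f us)) t k (card ?S) (\<lambda>i. (rs @ map f us) ! i)"
  proof (rule covering_array_nth)
    show "set (rs @ map f us) \<subseteq> ?K \<rightarrow>\<^sub>E ?S"
      using rs(2) f us(1) by auto
    show "\<exists>r\<in>set (rs @ map f us). covers r u" if "u \<in> interactions ?K ?S t" for u
      using f[of u] us(1) that by (cases "u \<in> U") (auto simp: U_def)
  qed simp
  then have "\<exists>A. covering_array ?S (n + card U) t k v A"
    using rs(1) us(2) by auto
  \<comment> \<open>\<open>0 < n\<close> supplies the positive number of rows that
    \<open>CAN\<close> demands.\<close>
  then have "CAN t k v \<le> n + card U"
    unfolding CAN_def using assms(3) by (intro Least_le) auto
  then show ?thesis
    using le by (intro that) (auto simp: U_def card_interactions)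
qed

text \<open>With \<open>s = t - 1\<close> the base is the reciprocal of \<open>1 + 1 / s\<close>,
  which is at most \<open>exp (1 / s)\<close>; raising to the power \<open>s\<close> gives the
  claim.\<close>

lemma exp_minus_one_le:
  assumes "2 \<le> t"
  shows "exp (- 1) \<le> (1 - 1 / real t) ^ (t - 1)"
proof -
  define s where "s = real (t - 1)"
  have s: "s \<ge> 1" "real t = s + 1" using assms by (auto simp: s_def)
  have "1 + 1 / s \<le> exp (1 / s)" by (rule exp_ge_add_one_self)
  then have "exp (- (1 / s)) \<le> inverse (1 + 1 / s)"
    using s by (simp add: exp_minus le_imp_inverse_le add_pos_nonneg)
  also have "\<dots> = 1 - 1 / real t"
    using s by (simp add: field_simps)
  finally have "exp (- (1 / s)) ^ (t - 1) \<le> (1 - 1 / real t) ^ (t - 1)"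
    by (intro power_mono) auto
  moreover have "exp (- (1 / s)) ^ (t - 1) = exp (s * - (1 / s))"
    unfolding s_def by (rule exp_of_nat_mult[symmetric])
  moreover have "s * - (1 / s) = - 1" using s by simp
  ultimately show ?thesis by simp
qed

text \<open>Absorption, then monotonicity in the upper index. This expresses the number of
  interactions through the binomial inside the logarithm, so that the two cancel.\<close>

lemma times_choose_le: "t * (k choose t) \<le> k * (k choose (t - 1))"
proof (cases "t = 0")
  case False
  then have "t * (k choose t) = k * ((k - 1) choose (t - 1))"
    by (simp add: times_binomial_minus1_eq)
  also have "\<dots> \<le> k * (k choose (t - 1))"
    by (intro mult_left_mono binomial_right_mono) auto
  finally show ?thesis .
qed simp

theorem mainTheorem5:
  fixes t k v :: nat
  assumes "2 \<le> t" and "t \<le> k" and "2 \<le> v"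
  shows "real (CAN t k v) \<le>
      ln (exp 1 * real t * real (k choose (t - 1))) / ln (real v ^ t / (real v ^ t - 1))
      + real_of_int \<lfloor>real k * (exp (real t) * (real v ^ t - 1) / (real t)\<^sup>2)
                      * (1 - 1 / real t) ^ (t - 1)\<rfloor>"
proof -
  define w where "w = real v ^ t"
  define B where "B = real (k choose (t - 1))"
  define D where "D = exp 1 * real t * B"
  define L where "L = ln D / ln (w / (w - 1))"
  define q where "q = 1 - 1 / w"
  define G where "G = (1 - 1 / real t) ^ (t - 1)"
  define n where "n = nat \<lfloor>L\<rfloor>"
  have "(2::real) ^ 2 \<le> 2 ^ t" using assms by (intro power_increasing) auto
  also have "(2::real) ^ t \<le> w" unfolding w_def using assms by (intro power_mono) auto
  finally have w: "w \<ge> 4" by simp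
  have q: "0 < q" "q < 1" "q = inverse (w / (w - 1))" using w by (auto simp: q_def field_simps)
  have "k choose (t - 1) > 0" using assms by (simp add: zero_less_binomial)
  then have B: "B \<ge> 1" unfolding B_def by linarith
  have t: "real t \<ge> 2" using assms by simp
  have "1 * 1 \<le> real t * B" using t B by (intro mult_mono) auto
  then have D: "D \<ge> exp 1" by (simp add: D_def)
  then have D0: "D > 0" using exp_gt_zero[of "1::real"] by linarith
  have lnD: "ln D \<ge> 1" using D D0 by (simp add: ln_ge_iff)
  have lnq: "ln (w / (w - 1)) = - ln q" unfolding q(3) using w by (subst ln_inverse) auto
  \<comment> \<open>The denominator of \<open>L\<close> is at most 1 and its numerator at least 1,
    so \<open>L \<ge> 1\<close> and rounding down leaves at least one greedy row.\<close>
  have "ln (w / (w - 1)) \<le> w / (w - 1) - 1" using w by (intro ln_le_minus_one) auto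
  also have "\<dots> \<le> 1" using w by (simp add: field_simps)
  finally have "ln (w / (w - 1)) \<le> 1" .
  moreover have lnpos: "0 < ln (w / (w - 1))" using w by (intro ln_gt_zero) simp
  ultimately have L: "L \<ge> 1" using lnD by (simp add: L_def field_simps)
  then have n: "0 < n" "real n \<le> L" "L - 1 \<le> real n" unfolding n_def by linarith+
  \<comment> \<open>\<open>L\<close> is exactly the exponent at which the uncovered fraction drops
    to \<open>1 / D\<close>.\<close>
  have "q powr L = exp (- ln D)"
    using q(1) lnpos unfolding powr_def L_def lnq by simp
  then have qL: "q powr L = 1 / D" using D0 by (simp add: exp_minus field_simps)
  have "q ^ n = q powr real n" using q by (simp add: powr_realpow)
  \<comment> \<open>As \<open>q < 1\<close>, rounding \<open>L\<close> down costs at most a factor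
    \<open>1 / q\<close>.\<close>
  also have "\<dots> \<le> q powr (L - 1)" using n q by (intro powr_mono') auto
  also have "\<dots> = 1 / (D * q)" using q(1) qL by (simp add: powr_diff)
  finally have qn: "q ^ n \<le> 1 / (D * q)" .
  obtain m where m: "CAN t k v \<le> n + m" "real m \<le> q ^ n * (real (k choose t) * w)"
    using CAN_le_alteration[of t k v n] assms n by (auto simp: q_def w_def)
  have "real (t * (k choose t)) \<le> real (k * (k choose (t - 1)))"
    using times_choose_le of_nat_le_iff by blast
  then have ch: "real (k choose t) \<le> real k * B / real t"
    using t by (simp add: B_def field_simps)
  \<comment> \<open>This is what remains after removing \<open>real k / (real t)\<^sup>2\<close>. On
    the left, one \<open>w\<close> comes from the number of tuples and \<open>w / (w - 1)\<close> is
    the rounding loss \<open>1 / q\<close>. It suffices that \<open>w \<le> 2 * (w - 1)\<close>,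
    that \<open>4 \<le> exp (real t)\<close> and that \<open>G\<close> is at least
    \<open>exp (- 1)\<close>.\<close>
  have bound: "w\<^sup>2 / ((w - 1) * exp 1) \<le> (w - 1) * exp (real t) * G"
  proof -
    have "(1 + 1) \<le> exp (1::real)" by (rule exp_ge_add_one_self)
    then have "4 \<le> exp (2::real)"
      using mult_mono[of 2 "exp 1" 2 "exp (1::real)"] by (simp flip: exp_add)
    also have "\<dots> \<le> exp (real t)" using t by simp
    finally have e4: "4 \<le> exp (real t)" .
    have "w\<^sup>2 \<le> (2 * (w - 1))\<^sup>2" using w by (intro power_mono) auto
    also have "\<dots> = 4 * (w - 1)\<^sup>2" by (simp add: power2_eq_square algebra_simps)
    also have "\<dots> \<le> exp (real t) * (w - 1)\<^sup>2" using e4 by (intro mult_right_mono) auto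
    finally have "w\<^sup>2 / ((w - 1) * exp 1) \<le> exp (real t) * (w - 1)\<^sup>2 / ((w - 1) * exp 1)"
      using w by (intro divide_right_mono) auto
    also have "\<dots> = (w - 1) * exp (real t) * exp (- 1)"
      using w by (simp add: exp_minus field_simps power2_eq_square)
    also have "\<dots> \<le> (w - 1) * exp (real t) * G"
      using w exp_minus_one_le[OF assms(1)] by (intro mult_left_mono) (auto simp: G_def)
    finally show ?thesis .
  qed
  have "real m \<le> 1 / (D * q) * (real k * B / real t * w)"
    using m(2) qn ch w D0 q B
    by (elim order_trans, intro mult_mono) auto
  \<comment> \<open>\<open>B\<close> cancels against the \<open>B\<close> in \<open>D\<close>; one
    factor \<open>real t\<close> comes from \<open>D\<close>, the other from
    \<open>ch\<close>.\<close>
  also have "\<dots> = real k / (real t)\<^sup>2 * (w\<^sup>2 / ((w - 1) * exp 1))"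
    using B t w by (simp add: D_def q_def field_simps power2_eq_square)
  also have "\<dots> \<le> real k / (real t)\<^sup>2 * ((w - 1) * exp (real t) * G)"
    using bound by (intro mult_left_mono) auto
  finally have "real m \<le> real k / (real t)\<^sup>2 * ((w - 1) * exp (real t) * G)" .
  then have "real m \<le> real k * (exp (real t) * (w - 1) / (real t)\<^sup>2) * G"
    by (simp add: mult_ac)
  \<comment> \<open>Since \<open>m\<close> is an integer, the bound survives taking the
    floor.\<close>
  then have "int m \<le> \<lfloor>real k * (exp (real t) * (w - 1) / (real t)\<^sup>2) * G\<rfloor>"
    by (simp add: le_floor_iff)
  then have "real m \<le> real_of_int \<lfloor>real k * (exp (real t) * (w - 1) / (real t)\<^sup>2) * G\<rfloor>"
    by linarith
  moreover have "real (CAN t k v) \<le> real n + real m" using m(1) by linarith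
  ultimately have "real (CAN t k v) \<le>
      L + real_of_int \<lfloor>real k * (exp (real t) * (w - 1) / (real t)\<^sup>2) * G\<rfloor>"
    using n(2) by linarith
  then show ?thesis by (simp add: L_def D_def B_def w_def G_def)
qed

end
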